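(* The univariate polynomial $p(x)=x^2$ does not have a Handelman representation on the interval $[-1,1]$; that is, there do not exist a finite set of pairs $(a,b)\in\mathbb{N}^2$ and non-negative real numbers $\lambda_{a,b}\ge 0$ indexed by these pairs such that $x^2\equiv\sum_{(a,b)}\lambda_{a,b}(1-x)^a(1+x)^b$ as polynomials.
   Context: For a set $K=\{x: p_1(x)\ge0,\dots,p_m(x)\ge0\}$ defined by polynomials $p_1,\dots,p_m$, a Handelman representation of a polynomial $p$ over $K$ is an identity $p\equiv\sum_f\lambda_f f$ with finitely many non-negative real coefficients $\lambda_f\ge0$, where each $f$ is a power product $p_1^{n_1}\cdots p_m^{n_m}$ with $n_j\in\mathbb{N}$ (of any bounded degree). Here $[-1,1]$ is defined by the constraints $1-x\ge0$ and $1+x\ge0$. *)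

theory Defs
  imports "HOL-Computational_Algebra.Polynomial"
begin

definition constraint_set :: "real poly list \<Rightarrow> real set" where
  "constraint_set ps = {x. \<forall>p\<in>set ps. poly p x \<ge> 0}"

definition power_product :: "real poly list \<Rightarrow> nat list \<Rightarrow> real poly" where
  "power_product ps ns = (\<Prod>j<length ps. (ps ! j) ^ (ns ! j))"

(* A representation over K = constraint_set ps depends on the chosen constraints ps and not only
   on the set K, so ps itself is the argument. A power product is given by its list of exponents. *)
definition has_Handelman_representation :: "real poly list \<Rightarrow> real poly \<Rightarrow> bool" where
  "has_Handelman_representation ps p \<longleftrightarrow>
     (\<exists>(S :: nat list set) (c :: nat list \<Rightarrow> real).
        finite S \<and> (\<forall>ns\<in>S. length ns = length ps \<and> c ns \<ge> 0) \<and>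
        p = (\<Sum>ns\<in>S. smult (c ns) (power_product ps ns)))"

definition interval_constraints :: "real poly list" where
  "interval_constraints = [[:1, -1:], [:1, 1:]]"

lemma constraint_set_interval_constraints: "constraint_set interval_constraints = {-1..1}"
  by (auto simp: constraint_set_def interval_constraints_def)

end

theory Submission
  imports Defs
begin

text \<open>
  Evaluate at the interior point \<open>0\<close> of the interval. Both constraints \<open>1 - x\<close> and \<open>1 + x\<close> are
  positive there, and hence so is each of their power products. A combination of these with
  non-negative coefficients can therefore vanish at \<open>0\<close> only if all its coefficients are zero, that
  is, only if it is the zero polynomial. But \<open>x\<^sup>2\<close> vanishes at \<open>0\<close> without being zero.
\<close>

text \<open>
  The obstruction to a Handelman representation: at the point \<open>x\<close> the value is a sum of non-negative
  terms, so if it is zero then every term is, and positivity of \<open>f i\<close> at \<open>x\<close> forces \<open>c i = 0\<close>.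
\<close>

lemma nonneg_combination_eq_0_if_root:
  fixes f :: "'i \<Rightarrow> real poly"
  assumes "finite S"
    and nonneg: "\<And>i. i \<in> S \<Longrightarrow> c i \<ge> 0"
    and pos: "\<And>i. i \<in> S \<Longrightarrow> poly (f i) x > 0"
    and root: "poly (\<Sum>i\<in>S. smult (c i) (f i)) x = 0"
  shows "(\<Sum>i\<in>S. smult (c i) (f i)) = 0"
proof (intro sum.neutral ballI)
  fix i assume i: "i \<in> S"
  have "(\<Sum>i\<in>S. c i * poly (f i) x) = 0"
    using root by (simp add: poly_sum)
  moreover have "\<And>j. j \<in> S \<Longrightarrow> c j * poly (f j) x \<ge> 0"
    using nonneg pos by (simp add: less_imp_le)
  ultimately have "c i * poly (f i) x = 0"
    using i \<open>finite S\<close> by (simp add: sum_nonneg_eq_0_iff)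
  then show "smult (c i) (f i) = 0"
    using pos[OF i] by simp
qed

lemma poly_power_product_pos:
  assumes "\<And>p. p \<in> set ps \<Longrightarrow> poly p x > 0"
  shows "poly (power_product ps ns) x > 0"
  unfolding power_product_def poly_prod poly_power
  by (intro prod_pos) (simp add: assms)

lemma no_Handelman_representation_if_root:
  assumes "\<And>q. q \<in> set ps \<Longrightarrow> poly q x > 0" and "poly p x = 0" and "p \<noteq> 0"
  shows "\<not> has_Handelman_representation ps p"
proof
  assume "has_Handelman_representation ps p"
  then obtain S c where "finite S" "\<forall>ns\<in>S. length ns = length ps \<and> c ns \<ge> 0"
    and p: "p = (\<Sum>ns\<in>S. smult (c ns) (power_product ps ns))"
    unfolding has_Handelman_representation_def by blast
  then have "(\<Sum>ns\<in>S. smult (c ns) (power_product ps ns)) = 0"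
    using assms by (intro nonneg_combination_eq_0_if_root[where x = x] poly_power_product_pos) auto
  with p \<open>p \<noteq> 0\<close> show False by simp
qed

theorem proposition4p1:
  shows "\<not> has_Handelman_representation interval_constraints ([:0, 1:] ^ 2) \<and>
    \<not> (\<exists>(S :: (nat \<times> nat) set) (c :: nat \<times> nat \<Rightarrow> real).
          finite S \<and> (\<forall>(a, b)\<in>S. c (a, b) \<ge> 0) \<and>
          ([:0, 1:] ^ 2 :: real poly) =
            (\<Sum>(a, b)\<in>S. smult (c (a, b)) ([:1, -1:] ^ a * [:1, 1:] ^ b)))"
proof
  show "\<not> has_Handelman_representation interval_constraints ([:0, 1:] ^ 2)"
    by (rule no_Handelman_representation_if_root[where x = 0])
      (auto simp: interval_constraints_def)
next
  show "\<not> (\<exists>(S :: (nat \<times> nat) set) (c :: nat \<times> nat \<Rightarrow> real).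
          finite S \<and> (\<forall>(a, b)\<in>S. c (a, b) \<ge> 0) \<and>
          ([:0, 1:] ^ 2 :: real poly) =
            (\<Sum>(a, b)\<in>S. smult (c (a, b)) ([:1, -1:] ^ a * [:1, 1:] ^ b)))"
  proof (intro notI, elim exE conjE)
    fix S :: "(nat \<times> nat) set" and c :: "nat \<times> nat \<Rightarrow> real"
    assume "finite S" and nonneg: "\<forall>(a, b)\<in>S. c (a, b) \<ge> 0"
      and "([:0, 1:] ^ 2 :: real poly) =
            (\<Sum>(a, b)\<in>S. smult (c (a, b)) ([:1, -1:] ^ a * [:1, 1:] ^ b))"
    then have eq: "([:0, 1:] ^ 2 :: real poly) =
        (\<Sum>i\<in>S. smult (c i) ([:1, -1:] ^ fst i * [:1, 1:] ^ snd i))"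
      by (simp only: split_def prod.collapse)
    have "(\<Sum>i\<in>S. smult (c i) ([:1, -1:] ^ fst i * [:1, 1:] ^ snd i)) = 0"
    proof (rule nonneg_combination_eq_0_if_root[where x = 0])
      show "poly (\<Sum>i\<in>S. smult (c i) ([:1, -1:] ^ fst i * [:1, 1:] ^ snd i)) 0 = 0"
        unfolding eq[symmetric] by simp
    qed (use \<open>finite S\<close> nonneg in auto)
    with eq show False by simp
  qed
qed

end
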